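(* Let $\kappa\in(0,1)$, $\lambda=\sqrt{1-\kappa^2}$ and $\mu^+=\sqrt{\tfrac12(1+\kappa)}$. Let $\mathrm{dn}_2$ (constructed with modulus $\kappa$) and $y_4^+$ (constructed with parameter $\lambda$) be the elliptic functions defined in the context. Then, as meromorphic functions of $z\in\mathbb{C}$, $$\mathrm{dn}_2(2\,\mathrm{i}\,z)=1+\kappa\,\frac{y_4^+(z)-\mu^+}{y_4^+(z)+\mu^+}.$$
   Context: Here $F(a,b;c;x)$ denotes the Gauss hypergeometric function ${}_2F_1$. Definition of $\mathrm{dn}_2$: the map $T\mapsto\int_0^T F(\tfrac14,\tfrac34;\tfrac12;\kappa^2\sin^2 t)\,dt$ is a strictly increasing bijection $\mathbb{R}\to\mathbb{R}$; let $\phi:\mathbb{R}\to\mathbb{R}$ be its inverse. Put $\psi=\arcsin(\kappa\sin\phi)$ and $d=\cos\psi:\mathbb{R}\to\mathbb{R}$. The function $d$ satisfies $d(0)=1$ and $(d')^2=2(1-d)(d^2-\lambda^2)$, and it extends to an elliptic function on $\mathbb{C}$; $\mathrm{dn}_2$ is this elliptic extension of $d$. Definition of $y_4^+$: let $T_4(t)=8t^4-8t^2+1$ be the degree-four Chebyshev polynomial of the first kind; $y_4^+$ is the nonconstant meromorphic (on $\mathbb{C}$) solution of $(y')^2=T_4(y)-(1-2\lambda^2)=8y^4-8y^2+2\lambda^2$ with $y(0)=\mu^+$; it is an elliptic function. *)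

theory Defs
  imports "HOL-Complex_Analysis.Complex_Analysis"
begin

definition hypergeo_2F1 :: "real \<Rightarrow> real \<Rightarrow> real \<Rightarrow> real \<Rightarrow> real" where
  "hypergeo_2F1 a b c x = eval_fps (fps_hypergeo [a, b] [c] 1) x"

(* The interval integral is signed: for T < 0 it is minus the integral over [T, 0]. *)
definition dn2_integral :: "real \<Rightarrow> real \<Rightarrow> real" where
  "dn2_integral \<kappa> T =
     (LBINT t=ereal 0..ereal T. hypergeo_2F1 (1/4) (3/4) (1/2) (\<kappa>\<^sup>2 * (sin t)\<^sup>2))"

(* The genuine inverse function: for \<bar>\<kappa>\<bar> < 1, dn2_integral \<kappa> is a bijection of the real line. *)
definition dn2_phi :: "real \<Rightarrow> real \<Rightarrow> real" where
  "dn2_phi \<kappa> = inv (dn2_integral \<kappa>)"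

definition dn2_psi :: "real \<Rightarrow> real \<Rightarrow> real" where
  "dn2_psi \<kappa> u = arcsin (\<kappa> * sin (dn2_phi \<kappa> u))"

definition dn2_real :: "real \<Rightarrow> real \<Rightarrow> real" where
  "dn2_real \<kappa> u = cos (dn2_psi \<kappa> u)"

(* Meromorphic functions are represented by nicely meromorphic ones: all removable
   singularities are removed and the value at a pole is 0. *)
definition elliptic :: "(complex \<Rightarrow> complex) \<Rightarrow> bool" where
  "elliptic f \<longleftrightarrow> f nicely_meromorphic_on UNIV \<and>
     (\<exists>\<omega>\<^sub>1 \<omega>\<^sub>2. \<omega>\<^sub>1 \<noteq> 0 \<and> \<omega>\<^sub>2 / \<omega>\<^sub>1 \<notin> \<real> \<and>
        (\<forall>z. f (z + \<omega>\<^sub>1) = f z) \<and> (\<forall>z. f (z + \<omega>\<^sub>2) = f z))"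

definition is_dn2 :: "real \<Rightarrow> (complex \<Rightarrow> complex) \<Rightarrow> bool" where
  "is_dn2 \<kappa> f \<longleftrightarrow> elliptic f \<and> (\<forall>u::real. f (of_real u) = of_real (dn2_real \<kappa> u))"

definition cheb_T4 :: "complex \<Rightarrow> complex" where
  "cheb_T4 t = 8 * t ^ 4 - 8 * t ^ 2 + 1"

(* If \<mu> is a root of the quartic, the constant function \<mu> also solves the initial value
   problem; it is excluded explicitly. *)
definition is_y4 :: "real \<Rightarrow> real \<Rightarrow> (complex \<Rightarrow> complex) \<Rightarrow> bool" where
  "is_y4 lam \<mu> y \<longleftrightarrow>
     y nicely_meromorphic_on UNIV \<and> \<not> y constant_on UNIV \<and>
     (\<forall>z. \<not> is_pole y z \<longrightarrow> (deriv y z)\<^sup>2 = cheb_T4 (y z) - (1 - 2 * (of_real lam)\<^sup>2)) \<and>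
     y 0 = of_real \<mu>"

end

theory Submission
  imports Defs
begin

text \<open>
  Both sides solve \<open>(h')\<^sup>2 = 8 (h - 1) (h\<^sup>2 - \<lambda>\<^sup>2)\<close> near \<open>0\<close>, take the value \<open>1\<close> at \<open>0\<close> and are not
  constant. Differentiating and cancelling \<open>h'\<close> gives a second-order equation with initial values
  \<open>h 0 = 1\<close> and \<open>h' 0 = 0\<close>, whose holomorphic solution is unique; the identity theorem for
  meromorphic functions does the rest. The equation for \<open>dn\<^sub>2\<close> rests on the closed form of
  \<open>F(1/4, 3/4; 1/2; x\<^sup>2)\<close>.
\<close>

section \<open>Uniqueness for autonomous equations with polynomial right-hand side\<close>

text \<open>Differentiating the equation gives f' * (2 f'' - p'(f)) = 0. As \<open>f\<close> is not
  constant, f' is nonzero on a nonempty open set; there the second factor vanishes, and the identity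
  theorem carries this to all of \<open>S\<close>, zeros of f' included.\<close>

lemma deriv_square_poly_imp_second_deriv:
  fixes f :: "complex \<Rightarrow> complex"
  assumes f: "f holomorphic_on S" and S: "open S" "connected S"
    and nc: "\<not> f constant_on S"
    and ode: "\<And>z. z \<in> S \<Longrightarrow> (deriv f z)\<^sup>2 = poly p (f z)"
    and z: "z \<in> S"
  shows "2 * deriv (deriv f) z = poly (pderiv p) (f z)"
proof -
  have f': "deriv f holomorphic_on S"
    using holomorphic_deriv[OF f S(1)] .
  have f'': "deriv (deriv f) holomorphic_on S"
    using holomorphic_deriv[OF f' S(1)] .
  obtain w where w: "w \<in> S" "deriv f w \<noteq> 0"
  proof (rule ccontr)
    assume "\<not> thesis"
    then have "\<And>w. w \<in> S \<Longrightarrow> deriv f w = 0"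
      using that by blast
    then have "\<And>w. w \<in> S \<Longrightarrow> (f has_field_derivative 0) (at w)"
      using holomorphic_derivI[OF f S(1)] by metis
    then have "f constant_on S"
      using has_field_derivative_0_imp_constant_on S by blast
    then show False using nc by simp
  qed
  have prod: "deriv f u * (2 * deriv (deriv f) u - poly (pderiv p) (f u)) = 0" if u: "u \<in> S" for u
  proof -
    have lhs: "((\<lambda>x. (deriv f x)\<^sup>2) has_field_derivative 2 * deriv f u * deriv (deriv f) u) (at u)"
      by (rule derivative_eq_intros holomorphic_derivI[OF f' S(1) u] | simp)+
    have rhs: "((\<lambda>x. poly p (f x)) has_field_derivative poly (pderiv p) (f u) * deriv f u) (at u)"
      by (rule DERIV_chain2[OF poly_DERIV holomorphic_derivI[OF f S(1) u]])
    have "\<forall>\<^sub>F x in nhds u. (deriv f x)\<^sup>2 = poly p (f x)"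
      using eventually_nhds_in_open[OF S(1) u] by eventually_elim (rule ode)
    from DERIV_cong_ev[OF refl this refl, THEN iffD1, OF lhs] rhs
    have "2 * deriv f u * deriv (deriv f) u = poly (pderiv p) (f u) * deriv f u"
      by (rule DERIV_unique)
    then show ?thesis by (simp add: algebra_simps)
  qed
  define N where "N = {u \<in> S. deriv f u \<noteq> 0}"
  have "N = S \<inter> deriv f -` (- {0})" by (auto simp: N_def)
  then have "open N"
    using continuous_open_preimage[OF holomorphic_on_imp_continuous_on[OF f'] S(1), of "- {0}"]
    by (simp add: open_Compl)
  have "2 * deriv (deriv f) z - poly (pderiv p) (f z) = 0"
  proof (rule analytic_continuation_open[where g = "\<lambda>_. 0" and
        f = "\<lambda>u. 2 * deriv (deriv f) u - poly (pderiv p) (f u)", OF \<open>open N\<close> S(1) _ S(2)])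
    show "N \<noteq> {}" "N \<subseteq> S" using w by (auto simp: N_def)
    show "2 * deriv (deriv f) u - poly (pderiv p) (f u) = 0" if "u \<in> N" for u
      using that prod[of u] by (auto simp: N_def)
  qed (use z f f'' in \<open>auto intro!: holomorphic_intros poly_holomorphic_on\<close>)
  then show ?thesis by simp
qed

text \<open>The difference quotient of \<open>p\<close> at two arguments is itself a polynomial in
  both, built by Horner recursion; hence \<open>R\<close> is holomorphic even where \<open>f\<close>
  and \<open>g\<close> agree. This turns the nonlinear equations for \<open>f\<close> and
  \<open>g\<close> into a linear one for their difference.\<close>

lemma poly_diff_holomorphic_factor:
  fixes f g :: "complex \<Rightarrow> complex"
  assumes "f holomorphic_on S" "g holomorphic_on S"
  shows "\<exists>R. R holomorphic_on S \<and> (\<forall>z. poly p (f z) - poly p (g z) = (f z - g z) * R z)"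
proof (induction p)
  case 0
  show ?case by (rule exI[of _ "\<lambda>_. 0"]) simp
next
  case (pCons a p)
  then obtain R where R: "R holomorphic_on S"
    "\<And>z. poly p (f z) - poly p (g z) = (f z - g z) * R z" by blast
  have "(\<lambda>z. f z * R z + poly p (g z)) holomorphic_on S"
    using assms R by (intro holomorphic_intros poly_holomorphic_on)
  moreover have "poly (pCons a p) (f z) - poly (pCons a p) (g z) =
      (f z - g z) * (f z * R z + poly p (g z))" for z
  proof -
    have "poly (pCons a p) (f z) - poly (pCons a p) (g z) =
        f z * (poly p (f z) - poly p (g z)) + (f z - g z) * poly p (g z)"
      by (simp add: algebra_simps)
    then show ?thesis by (simp add: R(2) algebra_simps)
  qed
  ultimately show ?case by blast
qed

text \<open>All Taylor coefficients of \<open>D\<close> at \<open>c\<close> vanish: by the Leibniz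
  rule the derivative of order m + 2 is a combination of derivatives of \<open>D\<close> of order at
  most m, and orders 0 and 1 are the initial values.\<close>

lemma linear_second_order_zero:
  fixes D :: "complex \<Rightarrow> complex"
  assumes D: "D holomorphic_on S" and R: "R holomorphic_on S" and S: "open S" "connected S"
    and ode: "\<And>z. z \<in> S \<Longrightarrow> deriv (deriv D) z = D z * R z"
    and c: "c \<in> S" "D c = 0" "deriv D c = 0" and z: "z \<in> S"
  shows "D z = 0"
proof (rule holomorphic_fun_eq_0_on_connected[OF D S _ c(1) z])
  fix n
  show "(deriv ^^ n) D c = 0"
  proof (induction n rule: less_induct)
    case (less n)
    consider "n = 0" | "n = 1" | m where "n = Suc (Suc m)"
      by (metis One_nat_def not0_implies_Suc)
    then show ?case
    proof cases
      case 3
      have "\<forall>\<^sub>F x in nhds c. deriv (deriv D) x = D x * R x"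
        using eventually_nhds_in_open[OF S(1) c(1)] by eventually_elim (rule ode)
      then have "(deriv ^^ m) (deriv (deriv D)) c = (deriv ^^ m) (\<lambda>x. D x * R x) c"
        by (rule higher_deriv_cong_ev) simp
      also have "\<dots> = (\<Sum>i = 0..m. of_nat (m choose i) * (deriv ^^ i) D c * (deriv ^^ (m - i)) R c)"
        by (rule higher_deriv_mult[OF D R S(1) c(1)])
      also have "\<dots> = 0"
        using less 3 by (intro sum.neutral) auto
      finally show ?thesis
        by (simp add: 3 funpow_Suc_right del: funpow.simps)
    qed (use c in simp_all)
  qed
qed

text \<open>Since \<open>p\<close> vanishes at the initial value, the first-order equation alone does not determine
  the solution (the constant solves it as well); its derivative, the second-order
  equation \<open>2 f'' = p' (f)\<close>, does.\<close>

lemma nonconstant_solution_unique: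
  fixes f g :: "complex \<Rightarrow> complex"
  assumes f: "f holomorphic_on S" "\<not> f constant_on S"
      "\<And>z. z \<in> S \<Longrightarrow> (deriv f z)\<^sup>2 = poly p (f z)"
    and g: "g holomorphic_on S" "\<not> g constant_on S"
      "\<And>z. z \<in> S \<Longrightarrow> (deriv g z)\<^sup>2 = poly p (g z)"
    and S: "open S" "connected S"
    and c: "c \<in> S" "f c = a" "g c = a" "poly p a = 0" and z: "z \<in> S"
  shows "f z = g z"
proof -
  obtain R where R: "R holomorphic_on S"
    "\<And>z. poly (pderiv p) (f z) - poly (pderiv p) (g z) = (f z - g z) * R z"
    using poly_diff_holomorphic_factor[OF f(1) g(1)] by blast
  have d1: "deriv (\<lambda>w. f w - g w) u = deriv f u - deriv g u" if "u \<in> S" for u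
    using that f(1) g(1) S(1) by (intro deriv_diff holomorphic_on_imp_differentiable_at)
  have f': "deriv f holomorphic_on S" and g': "deriv g holomorphic_on S"
    using f g S by (auto intro: holomorphic_deriv)
  \<comment> \<open>Subtracting the two second-order equations gives a linear one for the
    difference; the coefficient is halved because of the factor 2 in 2 f'' = p'(f).\<close>
  have d2: "deriv (deriv (\<lambda>w. f w - g w)) u = (f u - g u) * (R u / 2)" if u: "u \<in> S" for u
  proof -
    have "\<forall>\<^sub>F x in nhds u. deriv (\<lambda>w. f w - g w) x = deriv f x - deriv g x"
      using eventually_nhds_in_open[OF S(1) u] by eventually_elim (rule d1)
    then have "deriv (deriv (\<lambda>w. f w - g w)) u = deriv (\<lambda>x. deriv f x - deriv g x) u"
      by (rule deriv_cong_ev) simp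
    also have "\<dots> = deriv (deriv f) u - deriv (deriv g) u"
      using u f' g' S(1) by (intro deriv_diff holomorphic_on_imp_differentiable_at)
    finally have "2 * deriv (deriv (\<lambda>w. f w - g w)) u =
        2 * deriv (deriv f) u - 2 * deriv (deriv g) u" by simp
    also have "\<dots> = (f u - g u) * R u"
      using deriv_square_poly_imp_second_deriv[OF f(1) S f(2,3) u]
        deriv_square_poly_imp_second_deriv[OF g(1) S g(2,3) u] R(2)[of u] by simp
    finally show ?thesis by (simp add: field_simps)
  qed
  have "f z - g z = 0"
  proof (rule linear_second_order_zero[where R = "\<lambda>u. R u / 2", OF _ _ S d2 c(1) _ _ z])
    \<comment> \<open>The second initial condition comes from the first-order equation itself, as
      \<open>a\<close> is a root of \<open>p\<close>.\<close>
    have "deriv f c = 0" "deriv g c = 0"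
      using f(3)[OF c(1)] g(3)[OF c(1)] c by auto
    then show "deriv (\<lambda>w. f w - g w) c = 0" using d1 c by simp
  qed (use f g R c in \<open>auto intro!: holomorphic_intros\<close>)
  then show ?thesis by simp
qed

section \<open>Closed form of the hypergeometric integrand\<close>

text \<open>The series is the even part of the binomial series of \<open>(1 + x) powr (- 1/2)\<close>.\<close>

lemma hypergeo_2F1_quarter_square:
  assumes x: "\<bar>x\<bar> < 1"
  shows "hypergeo_2F1 (1/4) (3/4) (1/2) (x\<^sup>2) =
    ((1 + x) powr (- 1/2) + (1 - x) powr (- 1/2)) / 2"
proof -
  define e where "e n = ((- 1/2 :: real) gchoose n)" for n
  have "(\<lambda>n. e n * x ^ n) sums (1 + x) powr (- 1/2)"
    using gen_binomial_real[OF x, of "- 1/2"] by (simp add: e_def)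
  moreover have "(\<lambda>n. e n * (- x) ^ n) sums (1 - x) powr (- 1/2)"
    using gen_binomial_real[of "- x" "- 1/2"] x by (simp add: e_def)
  ultimately have "(\<lambda>n. (e n * x ^ n + e n * (- x) ^ n) / 2) sums
      (((1 + x) powr (- 1/2) + (1 - x) powr (- 1/2)) / 2)" (is "?s sums ?r")
    by (intro sums_divide sums_add)
  moreover have "?s n = 0" if "n \<notin> range (\<lambda>n. 2 * n)" for n
  proof -
    have "odd n" using that by (auto elim!: evenE)
    then show ?thesis by simp
  qed
  ultimately have "(\<lambda>n. ?s (2 * n)) sums ?r"
    by (subst sums_mono_reindex) (auto simp: strict_mono_def)
  moreover have "?s (2 * n) = fps_nth (fps_hypergeo [1/4, 3/4] [1/2] 1) n * (x\<^sup>2) ^ n" for n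
  proof -
    have ne: "pochhammer (1/2::real) n \<noteq> 0"
      using pochhammer_pos[of "1/2::real" n] by simp
    \<comment> \<open>The sign (-1)^(2n) in \<open>gbinomial_pochhammer\<close> is 1. The
      duplication formulas for the Pochhammer symbol and for the factorial each contribute 4^n,
      which cancels.\<close>
    have "e (2 * n) = pochhammer (1/2) (2 * n) / fact (2 * n)"
      by (simp add: e_def gbinomial_pochhammer)
    also have "\<dots> = pochhammer (1/4) n * pochhammer (3/4) n / (pochhammer (1/2) n * fact n)"
      using pochhammer_double[of "1/4::real" n] ne by (simp add: fact_double)
    finally have "e (2 * n) = pochhammer (1/4) n * pochhammer (3/4) n / (pochhammer (1/2) n * fact n)" .
    moreover have "x ^ (2 * n) = (x\<^sup>2) ^ n" "(- x) ^ (2 * n) = (x\<^sup>2) ^ n"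
      by (simp_all add: power_mult)
    ultimately show ?thesis by simp (simp add: mult.commute)
  qed
  ultimately have "(\<lambda>n. fps_nth (fps_hypergeo [1/4, 3/4] [1/2] 1) n * (x\<^sup>2) ^ n) sums ?r"
    by simp
  then show ?thesis
    unfolding hypergeo_2F1_def eval_fps_def by (rule sums_unique[symmetric])
qed

lemma hypergeo_2F1_quarter_square_sqrt:
  assumes x: "\<bar>x\<bar> < 1"
  shows "hypergeo_2F1 (1/4) (3/4) (1/2) (x\<^sup>2) = (1 / sqrt (1 + x) + 1 / sqrt (1 - x)) / 2"
  using x by (subst hypergeo_2F1_quarter_square) (auto simp: powr_minus_divide powr_half_sqrt)

text \<open>With a = sqrt (1 + x) and b = sqrt (1 - x) one has a^2 + b^2 = 2, so (a + b)^2 = 2 (1 +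
  a b). The square is thus rational in a b = sqrt (1 - x^2), which becomes the value of dn_2 once x
  is \<open>\<kappa> * sin T\<close>.\<close>

lemma hypergeo_2F1_quarter_square_squared:
  assumes x: "\<bar>x\<bar> < 1"
  shows "(hypergeo_2F1 (1/4) (3/4) (1/2) (x\<^sup>2))\<^sup>2 = (1 + sqrt (1 - x\<^sup>2)) / (2 * (1 - x\<^sup>2))"
proof -
  have x': "1 + x > 0" "1 - x > 0" using x by auto
  define a b where "a = sqrt (1 + x)" and "b = sqrt (1 - x)"
  have ab: "a > 0" "b > 0" "a\<^sup>2 + b\<^sup>2 = 2" using x' by (auto simp: a_def b_def)
  have ab2: "1 - x\<^sup>2 = (a * b)\<^sup>2"
    using x' by (simp add: a_def b_def power_mult_distrib) (simp add: power2_eq_square algebra_simps)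
  then have "sqrt (1 - x\<^sup>2) = a * b" using ab by simp
  moreover have "((1 / a + 1 / b) / 2)\<^sup>2 = (a + b)\<^sup>2 / (4 * (a * b)\<^sup>2)"
    using ab(1,2) by (simp add: field_simps power2_eq_square)
  moreover have "(a + b)\<^sup>2 = 2 * (1 + a * b)"
    using ab(3) by (simp add: power2_eq_square algebra_simps)
  ultimately show ?thesis
    using ab(1,2) unfolding hypergeo_2F1_quarter_square_sqrt[OF x] a_def[symmetric] b_def[symmetric] ab2
    by (simp add: field_simps)
qed

text \<open>By convention a nicely meromorphic function is 0 at its poles, so a nonzero value rules
  out a pole. This gives analyticity at 0 of both given functions, whose values there are 1 and
  \<open>\<mu>\<close>.\<close>

lemma nicely_meromorphic_nonzero_imp_analytic:
  assumes "f nicely_meromorphic_on A" "z \<in> A" "f z \<noteq> 0"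
  shows "f analytic_on {z}"
proof -
  have "f \<midarrow>z\<rightarrow> f z"
    using assms by (auto simp: nicely_meromorphic_on_def)
  then have "\<not> is_pole f z"
    using not_tendsto_and_filterlim_at_infinity[OF at_neq_bot] by (auto simp: is_pole_def)
  then show ?thesis
    using nicely_meromorphic_on_imp_analytic_at[OF assms(1,2)] by blast
qed

section \<open>The integral defining the amplitude, on the real line\<close>

context
  fixes \<kappa> :: real
  assumes \<kappa>: "0 < \<kappa>" "\<kappa> < 1"
begin

lemma abs_modulus_sin_less_1: "\<bar>\<kappa> * sin t\<bar> < 1"
proof -
  have "\<bar>\<kappa> * sin t\<bar> \<le> \<bar>\<kappa>\<bar> * 1"
    unfolding abs_mult by (intro mult_left_mono) auto
  then show ?thesis using \<kappa> by simp
qed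

text \<open>Since \<open>\<kappa> * sin t\<close> stays strictly between -1 and 1, the closed form
  shows that the integrand is continuous, and the fundamental theorem of calculus applies.\<close>

lemma dn2_integral_has_derivative:
  "(dn2_integral \<kappa> has_real_derivative
      hypergeo_2F1 (1/4) (3/4) (1/2) ((\<kappa> * sin T)\<^sup>2)) (at T)"
proof -
  define G where "G t = hypergeo_2F1 (1/4) (3/4) (1/2) ((\<kappa> * sin t)\<^sup>2)" for t
  have ne: "1 + \<kappa> * sin t > 0" "1 - \<kappa> * sin t > 0" for t
    using abs_modulus_sin_less_1[of t] by (auto simp: abs_less_iff)
  have "continuous_on A (\<lambda>t. (1 / sqrt (1 + \<kappa> * sin t) + 1 / sqrt (1 - \<kappa> * sin t)) / 2)" for A
    using ne by (intro continuous_intros) (auto simp: less_imp_neq[symmetric])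
  then have "continuous_on A G" for A
    by (simp add: G_def hypergeo_2F1_quarter_square_sqrt abs_modulus_sin_less_1)
  \<comment> \<open>The interval is chosen to contain 0 and to have \<open>T\<close> in its
    interior, so that the one-interval derivative is a full derivative.\<close>
  then have "((\<lambda>u. LBINT y=ereal 0..ereal u. G y) has_vector_derivative G T)
      (at T within {- \<bar>T\<bar> - 1..\<bar>T\<bar> + 1})"
    by (intro interval_integral_FTC2) auto
  then have "((\<lambda>u. LBINT y=ereal 0..ereal u. G y) has_vector_derivative G T) (at T)"
    by (subst (asm) at_within_interior) auto
  moreover have "dn2_integral \<kappa> = (\<lambda>u. LBINT y=ereal 0..ereal u. G y)"
    by (simp add: dn2_integral_def G_def fun_eq_iff power_mult_distrib)
  ultimately show ?thesis
    by (simp add: G_def has_real_derivative_iff_has_vector_derivative)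
qed

lemma dn2_integral_0: "dn2_integral \<kappa> 0 = 0"
  by (simp add: dn2_integral_def)

text \<open>The derivative is a sum of two positive terms in closed form. Injectivity lets the
  \<open>inv\<close> in \<open>dn2_phi\<close> cancel against \<open>dn2_integral\<close>.\<close>

lemma inj_dn2_integral: "inj (dn2_integral \<kappa>)"
proof -
  have pos: "hypergeo_2F1 (1/4) (3/4) (1/2) ((\<kappa> * sin t)\<^sup>2) > 0" for t
  proof -
    have "1 + \<kappa> * sin t > 0" "1 - \<kappa> * sin t > 0"
      using abs_modulus_sin_less_1[of t] by (auto simp: abs_less_iff)
    then show ?thesis
      by (simp add: hypergeo_2F1_quarter_square_sqrt abs_modulus_sin_less_1 add_pos_pos)
  qed
  have "strict_mono (dn2_integral \<kappa>)"
  proof (rule strict_monoI)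
    fix a b :: real assume "a < b"
    then show "dn2_integral \<kappa> a < dn2_integral \<kappa> b"
      by (rule DERIV_pos_imp_increasing) (use dn2_integral_has_derivative pos in blast)
  qed
  then show ?thesis by (rule strict_mono_imp_inj_on)
qed

lemma dn2_real_dn2_integral:
  "dn2_real \<kappa> (dn2_integral \<kappa> T) = sqrt (1 - (\<kappa> * sin T)\<^sup>2)"
  using abs_modulus_sin_less_1[of T]
  by (simp add: dn2_real_def dn2_psi_def dn2_phi_def inv_f_f[OF inj_dn2_integral]
      cos_arcsin abs_less_iff)

text \<open>Supplies the accumulating set of real points for the identity theorem:
  \<open>dn2_integral\<close> is continuous at 0 with value 0 and, being injective, nonzero
  elsewhere.\<close>

lemma zero_islimpt_dn2_integral:
  assumes "r > 0"
  shows "(0::complex) islimpt {of_real (dn2_integral \<kappa> T) |T. \<bar>dn2_integral \<kappa> T\<bar> < r}"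
proof -
  have lim: "dn2_integral \<kappa> \<midarrow>0\<rightarrow> 0"
    using DERIV_isCont[OF dn2_integral_has_derivative, of 0] by (simp add: isCont_def dn2_integral_0)
  have ne: "dn2_integral \<kappa> T \<noteq> 0" if "T \<noteq> 0" for T
    using inj_dn2_integral that dn2_integral_0 by (metis injD)
  show ?thesis
    unfolding islimpt_approachable
  proof (intro allI impI)
    fix e :: real assume "e > 0"
    then have "\<forall>\<^sub>F T in at 0. \<bar>dn2_integral \<kappa> T\<bar> < min e r"
      using tendstoD[OF lim, of "min e r"] assms by (simp add: dist_real_def)
    then have "\<forall>\<^sub>F T in at 0. \<bar>dn2_integral \<kappa> T\<bar> < min e r \<and> T \<noteq> 0"
      by (intro eventually_conj eventually_neq_at_within)
    then obtain T where "\<bar>dn2_integral \<kappa> T\<bar> < min e r" "T \<noteq> 0"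
      using eventually_happens[of _ "at (0::real)"] by auto
    then show "\<exists>x'\<in>{of_real (dn2_integral \<kappa> T) |T. \<bar>dn2_integral \<kappa> T\<bar> < r}.
        x' \<noteq> (0::complex) \<and> dist x' 0 < e"
      using ne by (intro bexI[of _ "of_real (dn2_integral \<kappa> T)"]) auto
  qed
qed

section \<open>Complex extensions of the real dn_2 and their differential equation\<close>

context
  fixes f :: "complex \<Rightarrow> complex"
  assumes f: "\<And>u::real. f (of_real u) = of_real (dn2_real \<kappa> u)"
begin

lemma dn2_extension_dn2_integral:
  "f (of_real (dn2_integral \<kappa> T)) = of_real (sqrt (1 - (\<kappa> * sin T)\<^sup>2))"
  by (simp add: f dn2_real_dn2_integral)

lemma dn2_extension_0: "f 0 = 1"
  using dn2_extension_dn2_integral[of 0] by (simp add: dn2_integral_0)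

text \<open>Parametrising the real points by the amplitude \<open>T\<close> avoids differentiating the inverse
  function \<^const>\<open>dn2_phi\<close>.\<close>

lemma dn2_extension_ode:
  assumes hol: "f holomorphic_on ball 0 r" and z: "z \<in> ball 0 r"
  shows "(deriv f z)\<^sup>2 = 2 * (1 - f z) * ((f z)\<^sup>2 - (1 - of_real (\<kappa>\<^sup>2)))"
proof -
  have r: "r > 0" using z by (metis ball_eq_empty empty_iff not_le)
  have "(deriv f z)\<^sup>2 - 2 * (1 - f z) * ((f z)\<^sup>2 - (1 - of_real (\<kappa>\<^sup>2))) = 0"
  \<comment> \<open>By the identity theorem it is enough to check the equation at the real points
    \<open>dn2_integral \<kappa> T\<close>, which accumulate at 0.\<close>
  proof (rule analytic_continuation[OF _ open_ball connected_ball _ _ zero_islimpt_dn2_integral[OF r] _ z])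
    show "(\<lambda>z. (deriv f z)\<^sup>2 - 2 * (1 - f z) * ((f z)\<^sup>2 - (1 - of_real (\<kappa>\<^sup>2)))) holomorphic_on ball 0 r"
      using hol by (intro holomorphic_intros) auto
    fix w :: complex assume "w \<in> {of_real (dn2_integral \<kappa> T) |T. \<bar>dn2_integral \<kappa> T\<bar> < r}"
    then obtain T where w: "w = of_real (dn2_integral \<kappa> T)" and wr: "\<bar>dn2_integral \<kappa> T\<bar> < r" by auto
    define s where "s = \<kappa> * sin T"
    define F where "F = hypergeo_2F1 (1/4) (3/4) (1/2) (s\<^sup>2)"
    define d where "d = sqrt (1 - s\<^sup>2)"
    have s1: "\<bar>s\<bar> < 1" unfolding s_def by (rule abs_modulus_sin_less_1)
    then have s2: "s\<^sup>2 < 1" by (simp add: abs_square_less_1)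
    then have d: "d > 0" "d\<^sup>2 = 1 - s\<^sup>2" by (auto simp: d_def)
    have F2: "F\<^sup>2 = (1 + d) / (2 * d\<^sup>2)"
      unfolding F_def hypergeo_2F1_quarter_square_squared[OF s1] d(2) by (simp add: d_def)
    have fw: "f w = of_real d"
      unfolding w dn2_extension_dn2_integral d_def s_def ..
    \<comment> \<open>The function of the amplitude is differentiated twice over: by the chain rule
      here, and from its explicit square-root form below. Comparison yields f'(w) as a real quotient
      \<open>q\<close>.\<close>
    have "((\<lambda>t. f (of_real (dn2_integral \<kappa> t))) has_vector_derivative deriv f w * of_real F) (at T)"
    proof -
      have "((\<lambda>t. of_real (dn2_integral \<kappa> t)) has_vector_derivative complex_of_real F) (at T)"
        using dn2_integral_has_derivative[of T] unfolding F_def s_def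
        by (intro has_vector_derivative_of_real)
          (simp add: has_real_derivative_iff_has_vector_derivative)
      moreover have "(f has_field_derivative deriv f w) (at (of_real (dn2_integral \<kappa> T)))"
        using holomorphic_derivI[OF hol open_ball, of w] wr by (simp add: w)
      ultimately show ?thesis
        using field_vector_diff_chain_at by (fastforce simp: o_def mult.commute)
    qed
    moreover have "((\<lambda>t. f (of_real (dn2_integral \<kappa> t))) has_vector_derivative
        of_real (- (s * \<kappa> * cos T / d))) (at T)"
    proof -
      have "((\<lambda>t. sqrt (1 - (\<kappa> * sin t)\<^sup>2)) has_real_derivative - (s * \<kappa> * cos T / d)) (at T)"
        using s2 unfolding s_def d_def
        by (auto intro!: derivative_eq_intros simp: field_simps power2_eq_square)
      then show ?thesis
        unfolding dn2_extension_dn2_integral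
        by (intro has_vector_derivative_of_real)
          (simp add: has_real_derivative_iff_has_vector_derivative)
    qed
    ultimately have eq: "deriv f w * of_real F = of_real (- (s * \<kappa> * cos T / d))"
      by (rule vector_derivative_unique_at)
    have F0: "F \<noteq> 0" using F2 d by auto
    define q where "q = - (s * \<kappa> * cos T / d) / F"
    have q: "deriv f w = of_real q"
    proof -
      have "deriv f w = of_real (- (s * \<kappa> * cos T / d)) / of_real F"
        using F0 by (subst eq_divide_eq) (simp add: eq del: of_real_minus of_real_divide of_real_mult)
      then show ?thesis by (simp add: q_def)
    qed
    have "\<kappa>\<^sup>2 * (cos T)\<^sup>2 = \<kappa>\<^sup>2 - s\<^sup>2"
      by (simp add: s_def power_mult_distrib cos_squared_eq algebra_simps)
    then have "q\<^sup>2 = s\<^sup>2 * (\<kappa>\<^sup>2 - s\<^sup>2) / (d\<^sup>2 * F\<^sup>2)"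
      by (simp add: q_def power_divide power_mult_distrib mult.assoc)
    also have "d\<^sup>2 * F\<^sup>2 = (1 + d) / 2"
      using d(1) by (simp add: F2)
    \<comment> \<open>The factor 1 + d of s^2 = (1 + d)(1 - d) cancels against the one coming from
      \<open>F\<close>, leaving a cubic in \<open>d\<close>.\<close>
    also have "s\<^sup>2 * (\<kappa>\<^sup>2 - s\<^sup>2) / ((1 + d) / 2) = 2 * (1 - d) * (d\<^sup>2 - (1 - \<kappa>\<^sup>2))"
    proof -
      have "s\<^sup>2 = (1 + d) * (1 - d)" using d(2) by (simp add: power2_eq_square algebra_simps)
      moreover have "\<kappa>\<^sup>2 - s\<^sup>2 = d\<^sup>2 - (1 - \<kappa>\<^sup>2)" using d(2) by simp
      ultimately have "s\<^sup>2 * (\<kappa>\<^sup>2 - s\<^sup>2) = (1 + d) * ((1 - d) * (d\<^sup>2 - (1 - \<kappa>\<^sup>2)))"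
        by (simp only: mult.assoc)
      then show ?thesis using d(1) by simp (simp add: algebra_simps)
    qed
    finally have "complex_of_real (q\<^sup>2) = of_real (2 * (1 - d) * (d\<^sup>2 - (1 - \<kappa>\<^sup>2)))" by simp
    then show "(deriv f w)\<^sup>2 - 2 * (1 - f w) * ((f w)\<^sup>2 - (1 - of_real (\<kappa>\<^sup>2))) = 0"
      by (simp add: q fw)
  qed (use r in auto)
  then show ?thesis by simp
qed

text \<open>At small T > 0 the value sqrt (1 - (\<kappa> sin T)^2) differs from the value 1 at
  0.\<close>

lemma dn2_extension_nonconstant:
  assumes r: "r > 0"
  shows "\<not> f constant_on ball 0 r"
proof
  assume "f constant_on ball 0 r"
  then have const: "f w = 1" if "w \<in> ball 0 r" for w
    using that r dn2_extension_0 by (metis centre_in_ball constant_on_def)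
  have "isCont (dn2_integral \<kappa>) 0"
    by (rule DERIV_isCont[OF dn2_integral_has_derivative])
  then obtain e where e: "e > 0" "\<And>T. \<bar>T\<bar> < e \<Longrightarrow> \<bar>dn2_integral \<kappa> T\<bar> < r"
    using r unfolding continuous_at_eps_delta by (auto simp: dn2_integral_0)
  \<comment> \<open>The bound 1 < pi makes \<open>sin T\<close> positive; the bound e / 2 keeps the
    point in the ball.\<close>
  define T where "T = min 1 (e / 2)"
  have T: "0 < T" "T \<le> 1" "\<bar>T\<bar> < e" using e(1) by (auto simp: T_def)
  then have "sin T > 0" using pi_gt3 by (intro sin_gt_zero) auto
  then have "sqrt (1 - (\<kappa> * sin T)\<^sup>2) \<noteq> 1" using \<kappa> by simp
  moreover have "f (of_real (dn2_integral \<kappa> T)) = 1"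
    using e(2)[OF T(3)] by (intro const) simp
  ultimately show False
    unfolding dn2_extension_dn2_integral of_real_eq_1_iff by blast
qed

end

end

section \<open>Comparison of the two sides near 0 and continuation to the plane\<close>

theorem theorem11:
  fixes \<kappa> lam \<mu> :: real and dn\<^sub>2 y :: "complex \<Rightarrow> complex"
  assumes "0 < \<kappa>" and "\<kappa> < 1"
    and "lam = sqrt (1 - \<kappa>\<^sup>2)"
    and "\<mu> = sqrt (1/2 * (1 + \<kappa>))"
    and "is_dn2 \<kappa> dn\<^sub>2"
    and "is_y4 lam \<mu> y"
  shows "\<forall>\<^sub>\<approx>z\<in>UNIV. dn\<^sub>2 (2 * \<i> * z) =
           1 + of_real \<kappa> * ((y z - of_real \<mu>) / (y z + of_real \<mu>))"
proof -
  define h where "h z = dn\<^sub>2 (2 * \<i> * z)" for z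
  define g where "g z = 1 + of_real \<kappa> * ((y z - of_real \<mu>) / (y z + of_real \<mu>))" for z
  \<comment> \<open>The expansion of 8 (x - 1)(x^2 - \<lambda>^2). It arises from the dn_2 equation
    2 (1 - d)(d^2 - \<lambda>^2) because the substitution \<open>2 * \<i> * z\<close> multiplies the
    squared derivative by -4.\<close>
  define p :: "complex poly" where
    "p = [:8 * (1 - of_real (\<kappa>\<^sup>2)), - 8 * (1 - of_real (\<kappa>\<^sup>2)), - 8, 8:]"
  have p: "poly p x = 8 * (x - 1) * (x\<^sup>2 - (1 - of_real (\<kappa>\<^sup>2)))" for x
    by (simp add: p_def algebra_simps power2_eq_square power3_eq_cube)
  have \<mu>: "\<mu> > 0" "\<mu>\<^sup>2 = (1 + \<kappa>) / 2" and lam: "lam\<^sup>2 = 1 - \<kappa>\<^sup>2"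
    using assms(1-4) by (auto simp: abs_square_le_1)
  have dn: "dn\<^sub>2 nicely_meromorphic_on UNIV" "\<And>u::real. dn\<^sub>2 (of_real u) = of_real (dn2_real \<kappa> u)"
    using assms(5) by (auto simp: is_dn2_def elliptic_def)
  have y: "y nicely_meromorphic_on UNIV" "\<not> y constant_on UNIV" "y 0 = of_real \<mu>"
    "\<And>z. \<not> is_pole y z \<Longrightarrow> (deriv y z)\<^sup>2 = cheb_T4 (y z) - (1 - 2 * (of_real lam)\<^sup>2)"
    using assms(6) by (auto simp: is_y4_def)
  have dn0: "dn\<^sub>2 0 = 1"
    by (rule dn2_extension_0[OF assms(1,2) dn(2)])
  have "dn\<^sub>2 analytic_on {0}"
    using nicely_meromorphic_nonzero_imp_analytic[OF dn(1)] dn0 by simp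
  then obtain r1 where r1: "r1 > 0" "dn\<^sub>2 holomorphic_on ball 0 r1"
    by (auto simp: analytic_on_def)
  have "y analytic_on {0}"
    using nicely_meromorphic_nonzero_imp_analytic[OF y(1)] y(3) \<mu>(1) by simp
  then obtain r2 where r2: "r2 > 0" "y holomorphic_on ball 0 r2"
    by (auto simp: analytic_on_def)
  have "continuous_on (ball 0 r2) (\<lambda>z. y z + of_real \<mu>)"
    using r2 by (intro continuous_intros holomorphic_on_imp_continuous_on)
  moreover have "y 0 + of_real \<mu> \<noteq> 0"
    using \<mu>(1) by (simp add: y(3) flip: of_real_add)
  ultimately obtain r3 where r3: "r3 > 0" "\<And>z. z \<in> ball 0 r3 \<Longrightarrow> y z + of_real \<mu> \<noteq> 0"
    using continuous_on_open_avoid[of "ball 0 r2" "\<lambda>z. y z + of_real \<mu>" 0 0] r2(1)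
    by (auto simp: mem_ball)
  \<comment> \<open>\<open>r1\<close> is halved because the argument \<open>2 * \<i> * z\<close> has
    twice the modulus of \<open>z\<close>.\<close>
  define r where "r = min (r1 / 2) (min r2 r3)"
  have r: "r > 0" using r1 r2 r3 by (auto simp: r_def)
  define B where "B = ball (0::complex) r"
  have B: "open B" "connected B" "0 \<in> B" using r by (auto simp: B_def)
  have B1: "2 * \<i> * z \<in> ball 0 r1" if "z \<in> B" for z
    using that by (simp add: B_def r_def norm_mult)
  have yB: "y holomorphic_on B" and yB0: "\<And>z. z \<in> B \<Longrightarrow> y z + of_real \<mu> \<noteq> 0"
    using r2(2) r3 by (auto simp: B_def r_def elim!: holomorphic_on_subset)
  have dn_deriv: "(dn\<^sub>2 has_field_derivative deriv dn\<^sub>2 (2 * \<i> * z)) (at (2 * \<i> * z))"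
    if "z \<in> B" for z
    using holomorphic_derivI[OF r1(2) open_ball B1[OF that]] .
  have h_deriv: "(h has_field_derivative deriv dn\<^sub>2 (2 * \<i> * z) * (2 * \<i>)) (at z)" if "z \<in> B" for z
    unfolding h_def by (rule DERIV_chain2[where g = "\<lambda>z. 2 * \<i> * z", OF dn_deriv[OF that]]) (auto intro!: derivative_eq_intros)
  have h_hol: "h holomorphic_on B"
    using h_deriv B(1) holomorphic_on_open by blast
  have h_ode: "(deriv h z)\<^sup>2 = poly p (h z)" if "z \<in> B" for z
  proof -
    have "(deriv h z)\<^sup>2 = - 4 * (deriv dn\<^sub>2 (2 * \<i> * z))\<^sup>2"
      by (simp add: DERIV_imp_deriv[OF h_deriv[OF that]] power_mult_distrib)
    then show ?thesis
      unfolding dn2_extension_ode[OF assms(1,2) dn(2) r1(2) B1[OF that]]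
      by (simp add: p h_def algebra_simps)
  qed
  have h_nc: "\<not> h constant_on B"
  proof
    assume "h constant_on B"
    then have h1: "h z = 1" if "z \<in> B" for z
      using that B(3) by (metis constant_on_def dn0 h_def mult_zero_right)
    have "dn\<^sub>2 z = 1" if "z \<in> ball 0 (2 * r)" for z
      using h1[of "z / (2 * \<i>)"] that by (simp add: h_def B_def norm_divide norm_mult)
    then have "dn\<^sub>2 constant_on ball 0 (2 * r)"
      unfolding constant_on_def by blast
    then show False
      using dn2_extension_nonconstant[OF assms(1,2) dn(2), of "2 * r"] r by simp
  qed
  have g_deriv: "(g has_field_derivative 
      of_real \<kappa> * (2 * of_real \<mu> * deriv y z / (y z + of_real \<mu>)\<^sup>2)) (at z)" if z: "z \<in> B" for z
    unfolding g_def
    by (rule derivative_eq_intros holomorphic_derivI[OF yB B(1) z] yB0[OF z] refl)+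
       (simp add: power2_eq_square algebra_simps)
  have g_hol: "g holomorphic_on B"
    using g_deriv B(1) holomorphic_on_open by blast
  have g_ode: "(deriv g z)\<^sup>2 = poly p (g z)" if z: "z \<in> B" for z
  proof -
    have "\<not> is_pole y z"
      using yB B(1) z not_is_pole_holomorphic by blast
    define m Y k where "m = complex_of_real \<mu>" and "Y = y z" and "k = complex_of_real \<kappa>"
    \<comment> \<open>Eliminating \<kappa> in favour of \<mu> factors the quartic, since 2
      \<lambda>^2 = 8 \<mu>^2 (1 - \<mu>^2): its roots are the square roots of \<mu>^2 and 1 -
      \<mu>^2.\<close>
    have "\<kappa> = 2 * \<mu>\<^sup>2 - 1" using \<mu>(2) by simp
    then have "k = of_real (2 * \<mu>\<^sup>2 - 1)" unfolding k_def by (rule arg_cong)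
    then have k: "k = 2 * m\<^sup>2 - 1" by (simp add: m_def)
    have l: "(of_real lam)\<^sup>2 = 1 - k\<^sup>2"
      by (simp add: k_def lam flip: of_real_power)
    have y': "(deriv y z)\<^sup>2 = 8 * (Y\<^sup>2 - m\<^sup>2) * (Y\<^sup>2 - (1 - m\<^sup>2))"
      using y(4)[OF \<open>\<not> is_pole y z\<close>] unfolding l cheb_T4_def Y_def[symmetric] k
      by (simp add: algebra_simps power2_eq_square eval_nat_numeral)
    have Ym: "Y + m \<noteq> 0" using yB0[OF z] by (simp add: Y_def m_def)
    \<comment> \<open>Now g = 1 + k w and p(g) = 8 (k w) k (k + 2 w + k w^2). Over the denominator
      (Y + m)^2, the factor w yields Y^2 - m^2 and the quadratic in w yields Y^2 - (1 - m^2), which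
      are the two factors of the quartic.\<close>
    define w where "w = (Y - m) / (Y + m)"
    have w: "w * (Y + m) = Y - m" using Ym by (simp add: w_def)
    have "(k + 2 * w + k * w\<^sup>2) * (Y + m)\<^sup>2 =
        k * (Y + m)\<^sup>2 + 2 * (w * (Y + m)) * (Y + m) + k * (w * (Y + m))\<^sup>2"
      by (simp add: power2_eq_square algebra_simps)
    also have "\<dots> = 4 * m\<^sup>2 * (Y\<^sup>2 - (1 - m\<^sup>2))"
      unfolding w k by (simp add: power2_eq_square algebra_simps)
    finally have quad: "k + 2 * w + k * w\<^sup>2 = 4 * m\<^sup>2 * (Y\<^sup>2 - (1 - m\<^sup>2)) / (Y + m)\<^sup>2"
      using Ym by (simp add: eq_divide_eq)
    have w': "w = (Y\<^sup>2 - m\<^sup>2) / (Y + m)\<^sup>2"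
      using Ym by (simp add: w_def power2_eq_square square_diff_square_factored)
    have "(deriv g z)\<^sup>2 = k\<^sup>2 * (4 * m\<^sup>2 * (8 * (Y\<^sup>2 - m\<^sup>2) * (Y\<^sup>2 - (1 - m\<^sup>2))) / ((Y + m)\<^sup>2)\<^sup>2)"
      unfolding y'[symmetric] DERIV_imp_deriv[OF g_deriv[OF z]]
      by (simp add: k_def m_def Y_def power_mult_distrib power_divide)
    also have "\<dots> = 8 * (k * ((Y\<^sup>2 - m\<^sup>2) / (Y + m)\<^sup>2)) *
        (k * (4 * m\<^sup>2 * (Y\<^sup>2 - (1 - m\<^sup>2)) / (Y + m)\<^sup>2))"
      by (simp add: power2_eq_square)
    also have "\<dots> = 8 * (k * w) * (k * (k + 2 * w + k * w\<^sup>2))"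
      unfolding quad unfolding w' ..
    also have "\<dots> = poly p (g z)"
      unfolding p g_def w_def Y_def m_def k_def
      by (simp add: power2_eq_square algebra_simps)
    finally show ?thesis .
  qed
  have g_nc: "\<not> g constant_on B"
  proof
    assume "g constant_on B"
    moreover have "g 0 = 1" by (simp add: g_def y(3))
    ultimately have "g z = 1" if "z \<in> B" for z
      using that B(3) by (metis constant_on_def)
    \<comment> \<open>As \<kappa> is nonzero, g = 1 forces y = \<mu> near 0, hence everywhere by
      continuation; this is the constant solution that \<open>is_y4\<close> excludes.\<close>
    then have "y z = of_real \<mu>" if "z \<in> B" for z
      using that yB0[of z] assms(1) by (fastforce simp: g_def)
    then have "y constant_on B" by (auto simp: constant_on_def)
    then have "y constant_on UNIV"
      using constant_on_extend_nicely_meromorphic_on[OF y(1)] B by blast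
    then show False using y(2) by simp
  qed
  have eq: "h z = g z" if "z \<in> B" for z
    using nonconstant_solution_unique[OF h_hol h_nc h_ode g_hol g_nc g_ode B(1,2,3) _ _ _ that, of 1]
    by (simp add: h_def g_def dn0 y(3) p)
  have "y meromorphic_on UNIV" "dn\<^sub>2 meromorphic_on UNIV"
    using y dn by (auto simp: nicely_meromorphic_on_def)
  then have "(\<lambda>z. h z - g z) meromorphic_on UNIV"
    unfolding h_def g_def
    by (intro meromorphic_intros meromorphic_on_compose[of "dn\<^sub>2" UNIV "\<lambda>z. 2 * \<i> * z"] analytic_intros) auto
  \<comment> \<open>On the connected plane a meromorphic function either equals 0 or avoids 0, up to
    a sparse set. Avoidance contradicts the equality on \<open>B\<close>.\<close>
  then consider "\<forall>\<^sub>\<approx>z\<in>UNIV. h z - g z = 0" | "\<forall>\<^sub>\<approx>z\<in>UNIV. h z - g z \<noteq> 0"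
    using meromorphic_imp_constant_or_avoid[of "\<lambda>z. h z - g z" UNIV 0] by auto
  then have "\<forall>\<^sub>\<approx>z\<in>UNIV. h z - g z = 0"
  proof cases
    case 2
    then have "\<forall>\<^sub>F z in at 0. h z \<noteq> g z"
      by (simp add: eventually_cosparse_open_eq)
    moreover have "\<forall>\<^sub>F z in at 0. h z = g z"
      using eventually_at_in_open'[OF B(1,3)] by eventually_elim (rule eq)
    ultimately have "\<forall>\<^sub>F z in at (0::complex). False"
      by eventually_elim simp
    then show ?thesis by simp
  qed
  then show ?thesis
    by (simp add: h_def g_def)
qed

end
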